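(* Let $n$ be a positive integer, let $\mathbb{F}$ be a field, and let $\mathcal{V}\subseteq\{0,1\}^n\subseteq\mathbb{F}^n$ be a finite set of $0$-$1$ vectors. Let $0\leq k\leq n$ be an integer such that $$\sum_{i=0}^k\binom{n}{i}<|\mathcal{V}|.$$ Then $$k<AC(\mathcal{V}),$$ i.e. there exists a vector $\mathbf{v}\in\mathcal{V}$ such that $k<AC(\mathcal{V},\mathbf{v})$.
   Context: For a finite set of points $\mathcal{V}\subseteq\mathbb{F}^n$ and $\mathbf{v}\in\mathcal{V}$, a finite set of affine hyperplanes $\{H_1,\ldots,H_m\}$ of $\mathbb{F}^n$ is an almost cover of $\mathcal{V}$ and $\mathbf{v}$ if the union $\bigcup_{j=1}^m H_j$ contains $\mathcal{V}\setminus\{\mathbf{v}\}$ but does not contain $\mathbf{v}$. $AC(\mathcal{V},\mathbf{v})$ denotes the minimum size (number of hyperplanes) of an almost cover of $\mathcal{V}$ and $\mathbf{v}$, and $AC(\mathcal{V}):=\max_{\mathbf{v}\in\mathcal{V}}AC(\mathcal{V},\mathbf{v})$. *)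

theory Defs
  imports "HOL-Analysis.Analysis"
begin

text \<open>
  The library's hyperplanes live in real inner product spaces, so hyperplanes over an arbitrary
  field are introduced here. The space \<open>F\<^sup>n\<close> is \<open>'a ^ 'n\<close> with \<open>'a\<close> a field and \<open>n = CARD('n)\<close>.
\<close>

definition affine_hyperplane :: "('a::field ^ 'n) set \<Rightarrow> bool" where
  "affine_hyperplane H \<longleftrightarrow>
     (\<exists>a b. a \<noteq> 0 \<and> H = {x. (\<Sum>i\<in>UNIV. a $ i * x $ i) = b})"

definition almost_cover ::
  "('a::field ^ 'n) set set \<Rightarrow> ('a ^ 'n) set \<Rightarrow> 'a ^ 'n \<Rightarrow> bool" where
  "almost_cover \<H> V v \<longleftrightarrow>
     finite \<H> \<and> (\<forall>H\<in>\<H>. affine_hyperplane H) \<and> V - {v} \<subseteq> \<Union>\<H> \<and> v \<notin> \<Union>\<H>"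

text \<open>
  For finite \<open>V\<close> an almost cover always exists (see \<open>almost_cover_exists\<close> below), so
  the least size is a genuine minimum.
\<close>

definition AC_at :: "('a::field ^ 'n) set \<Rightarrow> 'a ^ 'n \<Rightarrow> nat" where
  "AC_at V v = (LEAST m. \<exists>\<H>. almost_cover \<H> V v \<and> card \<H> = m)"

text \<open>Meaningful for finite nonempty \<open>V\<close> only, as \<open>Max\<close> is otherwise unspecified.\<close>

definition AC :: "('a::field ^ 'n) set \<Rightarrow> nat" where
  "AC V = Max (AC_at V ` V)"

lemma almost_cover_exists:
  fixes V :: "('a::field ^ 'n) set"
  assumes "finite V"
  shows "\<exists>\<H>. almost_cover \<H> V v"
proof -
  have "\<exists>H. affine_hyperplane H \<and> w \<in> H \<and> v \<notin> H" if ne: "w \<noteq> v" for w :: "'a ^ 'n"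
  proof -
    obtain i where i: "w $ i \<noteq> v $ i"
      using ne by (auto simp: vec_eq_iff)
    have sum_axis: "(\<Sum>j\<in>UNIV. axis i 1 $ j * x $ j) = x $ i" for x :: "'a ^ 'n"
      by (simp add: axis_def if_distrib[of "\<lambda>c. c * _"] sum.delta' cong: if_cong)
    have "affine_hyperplane {x :: 'a ^ 'n. (\<Sum>j\<in>UNIV. axis i 1 $ j * x $ j) = w $ i}"
      unfolding affine_hyperplane_def by (auto intro!: exI[of _ "axis i 1"] simp: axis_eq_0_iff)
    then show ?thesis
      using i by (intro exI) (auto simp: sum_axis)
  qed
  then obtain h where h: "\<And>w. w \<noteq> v \<Longrightarrow> affine_hyperplane (h w) \<and> w \<in> h w \<and> v \<notin> h w"
    by metis
  have "almost_cover (h ` (V - {v})) V v"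
    unfolding almost_cover_def using assms h by auto
  then show ?thesis ..
qed

end

theory Submission
  imports Defs "HOL-Library.Function_Algebras"
begin

text \<open>
  If every point \<open>v\<close> of \<open>V\<close> has an almost cover by at most \<open>k\<close> hyperplanes, then the product of
  their equations is a polynomial of degree at most \<open>k\<close> that is nonzero at \<open>v\<close> and vanishes on the
  rest of \<open>V\<close>. Since \<open>x\<^sup>2 = x\<close> on \<open>{0, 1}\<close>, its restriction to \<open>V\<close> is a combination of multilinear
  monomials of degree at most \<open>k\<close>. So these monomials span all functions on \<open>V\<close>, and there
  are at least \<open>card V\<close> of them.
\<close>

text \<open>Zero and addition are the pointwise ones on functions, so only the pointwise scaling is
  given explicitly.\<close>

interpretation fun_space: vector_space "\<lambda>(c::'a::field) (f::'b \<Rightarrow> 'a) x. c * f x"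
  by unfold_locales (auto simp: fun_eq_iff algebra_simps)

lemma sum_fun_apply: "(\<Sum>i\<in>I. f i) x = (\<Sum>i\<in>I. f i x)"
  for f :: "'i \<Rightarrow> 'b \<Rightarrow> 'a::comm_monoid_add"
  by (induction I rule: infinite_finite_induct) auto

text \<open>Functions on \<open>V\<close> are encoded as functions on the whole space that vanish outside \<open>V\<close>.\<close>

definition multilinear_monomial :: "('a::field ^ 'n) set \<Rightarrow> 'n set \<Rightarrow> 'a ^ 'n \<Rightarrow> 'a" where
  "multilinear_monomial V S = (\<lambda>x. if x \<in> V then \<Prod>i\<in>S. x $ i else 0)"

text \<open>For a set \<open>V\<close> of 0-1 vectors, these are the restrictions to
  \<open>V\<close> of all polynomials of degree at most \<open>k\<close>.\<close>

definition multilinear_span :: "('a::field ^ 'n) set \<Rightarrow> nat \<Rightarrow> ('a ^ 'n \<Rightarrow> 'a) set" where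
  "multilinear_span V k = fun_space.span (multilinear_monomial V ` {S. card S \<le> k})"

lemma card_subsets_card_le:
  "card {S :: 'n::finite set. card S \<le> k} = (\<Sum>i=0..k. CARD('n) choose i)"
proof -
  have "{S :: 'n set. card S \<le> k} = (\<Union>i\<in>{0..k}. {S. card S = i})"
    by auto
  also have "card \<dots> = (\<Sum>i=0..k. card {S :: 'n set. card S = i})"
    by (rule card_UN_disjoint) auto
  also have "\<dots> = (\<Sum>i=0..k. CARD('n) choose i)"
    using n_subsets[of "UNIV :: 'n set"] by simp
  finally show ?thesis .
qed

text \<open>This is where the 0-1 coordinates enter: if \<open>i\<close> already lies in
  \<open>S\<close>, the extra factor is absorbed by \<open>x $ i * x $ i = x $ i\<close>. Off
  \<open>V\<close> both sides are 0.\<close>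

lemma coordinate_mult_monomial:
  assumes "\<forall>x\<in>V. \<forall>i. x $ i \<in> {0, 1}"
  shows "x $ i * multilinear_monomial V S x = multilinear_monomial V (insert i S) x"
proof (cases "x \<in> V \<and> i \<in> S")
  case True
  then have "x $ i * x $ i = x $ i"
    using assms by fastforce
  with True show ?thesis
    by (simp add: multilinear_monomial_def insert_absorb prod.remove[of S i] mult.assoc[symmetric])
next
  case False
  then show ?thesis
    by (auto simp: multilinear_monomial_def)
qed

text \<open>The term \<open>a $ i * x $ i\<close> of the affine form only replaces \<open>S\<close>
  by \<open>insert i S\<close>, and the constant term keeps \<open>S\<close>; hence the degree bound
  rises by at most one.\<close>

lemma affine_mult_monomial_in_span:
  fixes V :: "('a::field ^ 'n) set"
  assumes V: "\<forall>x\<in>V. \<forall>i. x $ i \<in> {0, 1}" and S: "card S \<le> k"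
  shows "(\<lambda>x. ((\<Sum>i\<in>UNIV. a $ i * x $ i) - b) * multilinear_monomial V S x)
    \<in> multilinear_span V (Suc k)"
proof -
  have S': "multilinear_monomial V (insert i S) \<in> multilinear_span V (Suc k)" for i
    unfolding multilinear_span_def
    using S by (intro fun_space.span_base imageI) (simp add: card_insert_if)
  have S'': "multilinear_monomial V S \<in> multilinear_span V (Suc k)"
    unfolding multilinear_span_def
    using S by (intro fun_space.span_base imageI) simp
  have "(\<lambda>x. ((\<Sum>i\<in>UNIV. a $ i * x $ i) - b) * multilinear_monomial V S x)
      = (\<Sum>i\<in>UNIV. (\<lambda>x. a $ i * multilinear_monomial V (insert i S) x))
        - (\<lambda>x. b * multilinear_monomial V S x)"
    by (simp add: fun_eq_iff sum_fun_apply left_diff_distrib sum_distrib_right mult.assoc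
        coordinate_mult_monomial[OF V])
  also have "\<dots> \<in> multilinear_span V (Suc k)"
    using S' S'' unfolding multilinear_span_def
    by (intro fun_space.span_diff fun_space.span_sum fun_space.span_scale) auto
  finally show ?thesis .
qed

lemma affine_mult_in_span:
  fixes V :: "('a::field ^ 'n) set"
  assumes V: "\<forall>x\<in>V. \<forall>i. x $ i \<in> {0, 1}" and f: "f \<in> multilinear_span V k"
  shows "(\<lambda>x. ((\<Sum>i\<in>UNIV. a $ i * x $ i) - b) * f x) \<in> multilinear_span V (Suc k)"
  using f unfolding multilinear_span_def
proof (induction rule: fun_space.span_induct_alt)
  case base
  show ?case
    using fun_space.span_zero by (simp add: zero_fun_def)
next
  case (step c g f)
  have "(\<lambda>x. ((\<Sum>i\<in>UNIV. a $ i * x $ i) - b) * ((\<lambda>x. c * g x) + f) x)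
      = (\<lambda>x. c * (((\<Sum>i\<in>UNIV. a $ i * x $ i) - b) * g x))
        + (\<lambda>x. ((\<Sum>i\<in>UNIV. a $ i * x $ i) - b) * f x)"
    by (simp add: fun_eq_iff algebra_simps)
  moreover have "(\<lambda>x. ((\<Sum>i\<in>UNIV. a $ i * x $ i) - b) * g x)
      \<in> fun_space.span (multilinear_monomial V ` {S. card S \<le> Suc k})"
    using step.hyps affine_mult_monomial_in_span[OF V] unfolding multilinear_span_def by auto
  ultimately show ?case
    using step.IH by (simp only: fun_space.span_add fun_space.span_scale)
qed

text \<open>The function is the product of the equations of the hyperplanes, each factor costing one
  degree. Its zeros on \<open>V\<close> are exactly the covered points because a field has no zero
  divisors.\<close>

lemma hyperplanes_polynomial:
  fixes V :: "('a::field ^ 'n) set"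
  assumes V: "\<forall>x\<in>V. \<forall>i. x $ i \<in> {0, 1}"
    and "finite \<H>" "\<forall>H\<in>\<H>. affine_hyperplane H"
  obtains f where "f \<in> multilinear_span V (card \<H>)" "\<And>x. f x = 0 \<longleftrightarrow> x \<notin> V \<or> x \<in> \<Union>\<H>"
proof -
  have "\<exists>f\<in>multilinear_span V (card \<H>). \<forall>x. f x = 0 \<longleftrightarrow> x \<notin> V \<or> x \<in> \<Union>\<H>"
    using assms(2,3)
  proof (induction rule: finite_induct)
    case empty
    \<comment> \<open>The empty product is the indicator function of \<open>V\<close>.\<close>
    have "multilinear_monomial V {} \<in> multilinear_span V 0"
      unfolding multilinear_span_def by (intro fun_space.span_base imageI) simp
    then show ?case
      by (intro bexI[of _ "multilinear_monomial V {}"]) (auto simp: multilinear_monomial_def)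
  next
    case (insert H \<H>)
    then obtain f where f: "f \<in> multilinear_span V (card \<H>)"
      "\<And>x. f x = 0 \<longleftrightarrow> x \<notin> V \<or> x \<in> \<Union>\<H>"
      by auto
    obtain a b where H: "H = {x. (\<Sum>i\<in>UNIV. a $ i * x $ i) = b}"
      using insert.prems unfolding affine_hyperplane_def by auto
    show ?case
      using affine_mult_in_span[OF V f(1), of a b] insert.hyps f(2) H
      by (intro bexI[of _ "\<lambda>x. ((\<Sum>i\<in>UNIV. a $ i * x $ i) - b) * f x"]) auto
  qed
  then show thesis
    using that by blast
qed

lemma multilinear_span_mono:
  assumes "j \<le> k"
  shows "multilinear_span V j \<subseteq> multilinear_span V k"
  unfolding multilinear_span_def
  using assms by (intro fun_space.span_mono image_mono) auto

lemma point_function_in_span: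
  fixes V :: "('a::field ^ 'n) set"
  assumes V: "\<forall>x\<in>V. \<forall>i. x $ i \<in> {0, 1}"
    and v: "v \<in> V" and cover: "almost_cover \<H> V v" and k: "card \<H> \<le> k"
  shows "(\<lambda>x. if x = v then 1 else 0) \<in> multilinear_span V k"
proof -
  obtain f where f: "f \<in> multilinear_span V (card \<H>)"
    and zero: "\<And>x. f x = 0 \<longleftrightarrow> x \<notin> V \<or> x \<in> \<Union>\<H>"
    using hyperplanes_polynomial[OF V] cover unfolding almost_cover_def by metis
  \<comment> \<open>The cover misses \<open>v\<close>, so \<open>f v\<close> is invertible; it
    contains the rest of \<open>V\<close>, so \<open>f\<close> vanishes everywhere else.\<close>
  have "(\<lambda>x. if x = v then 1 else 0) = (\<lambda>x. inverse (f v) * f x)"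
    using zero v cover unfolding almost_cover_def by (fastforce simp: fun_eq_iff)
  moreover have "f \<in> multilinear_span V k"
    using f multilinear_span_mono[OF k] by blast
  ultimately show ?thesis
    unfolding multilinear_span_def by (simp only: fun_space.span_scale)
qed

lemma inj_point_function: "inj (\<lambda>v x. if x = v then 1 else (0::'a::field))"
  by (rule injI) (metis one_neq_zero)

lemma independent_point_functions:
  fixes V :: "'b set"
  assumes "finite V"
  shows "fun_space.independent ((\<lambda>v x. if x = v then 1 else (0::'a::field)) ` V)"
    (is "fun_space.independent (?\<delta> ` V)")
proof (rule fun_space.independent_if_scalars_zero)
  have inj: "inj_on ?\<delta> V"
    by (rule inj_on_subset[OF inj_point_function]) simp
  fix u g
  assume sum0: "(\<Sum>g\<in>?\<delta> ` V. (\<lambda>x. u g * g x)) = 0" and "g \<in> ?\<delta> ` V"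
  then obtain v where v: "v \<in> V" "g = ?\<delta> v"
    by blast
  \<comment> \<open>Evaluating the vanishing combination at \<open>v\<close> isolates the
    coefficient of \<open>?\<delta> v\<close>.\<close>
  have "(\<Sum>w\<in>V. u (?\<delta> w) * ?\<delta> w v) = 0"
    using fun_cong[OF sum0, of v] by (simp add: sum_fun_apply sum.reindex[OF inj])
  moreover have "(\<Sum>w\<in>V. u (?\<delta> w) * ?\<delta> w v) = u (?\<delta> v)"
    using assms v by (simp add: if_distrib[of "\<lambda>c. _ * c"] sum.delta cong: if_cong)
  ultimately show "u g = 0"
    using v by simp
qed (use assms in simp)

text \<open>\<open>LEAST\<close> yields an attained value only if some almost cover exists, which
  finiteness of \<open>V\<close> ensures.\<close>

lemma AC_at_attained:
  assumes "finite V"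
  obtains \<H> where "almost_cover \<H> V v" "card \<H> = AC_at V v"
proof -
  have "\<exists>m \<H>. almost_cover \<H> V v \<and> card \<H> = m"
    using almost_cover_exists[OF assms] by blast
  then show thesis
    using that LeastI_ex[of "\<lambda>m. \<exists>\<H>. almost_cover \<H> V v \<and> card \<H> = m"]
    unfolding AC_at_def by blast
qed

text \<open>The point functions are \<open>card V\<close> independent vectors in the span of the
  monomials, so by the exchange lemma they are at most as many as the monomials.\<close>

lemma card_le_if_AC_at_le:
  fixes V :: "('a::field ^ 'n) set"
  assumes fin: "finite V" and V: "\<forall>x\<in>V. \<forall>i. x $ i \<in> {0, 1}"
    and le: "\<forall>v\<in>V. AC_at V v \<le> k"
  shows "card V \<le> (\<Sum>i=0..k. CARD('n) choose i)"
proof -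
  let ?\<delta> = "\<lambda>v x. if x = v then 1 else (0::'a)"
  let ?M = "multilinear_monomial V ` {S. card S \<le> k}"
  have "?\<delta> ` V \<subseteq> fun_space.span ?M"
  proof (rule image_subsetI)
    fix v
    assume "v \<in> V"
    moreover obtain \<H> where "almost_cover \<H> V v" "card \<H> = AC_at V v"
      using AC_at_attained[OF fin] by blast
    ultimately show "?\<delta> v \<in> fun_space.span ?M"
      using point_function_in_span[OF V] le unfolding multilinear_span_def by auto
  qed
  then have "card (?\<delta> ` V) \<le> card ?M"
    using fun_space.independent_span_bound[OF _ independent_point_functions[OF fin], of ?M]
    by simp
  \<comment> \<open>Distinct index sets may give the same function on \<open>V\<close>, so the
    number of subsets is only an upper bound.\<close>
  also have "\<dots> \<le> (\<Sum>i=0..k. CARD('n) choose i)"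
    using card_image_le[of "{S :: 'n set. card S \<le> k}"] by (simp add: card_subsets_card_le)
  finally show ?thesis
    by (simp add: card_image inj_on_subset[OF inj_point_function])
qed

theorem theorem1p8:
  fixes V :: "('a::field ^ 'n) set" and k :: nat
  assumes "finite V"
    and "\<forall>v\<in>V. \<forall>i. v $ i \<in> {0, 1}"
    and "k \<le> CARD('n)"
    and "(\<Sum>i=0..k. CARD('n) choose i) < card V"
  shows "k < AC V \<and> (\<exists>v\<in>V. k < AC_at V v)"
proof -
  obtain v where v: "v \<in> V" "k < AC_at V v"
    using card_le_if_AC_at_le[OF assms(1,2)] assms(4) by (meson not_le)
  moreover have "AC_at V v \<le> AC V"
    unfolding AC_def using assms(1) v by (intro Max_ge) auto
  ultimately show ?thesis
    by auto
qed

end
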